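(* Consider the axisymmetric Euler equations in the dynamic rescaling formulation described in the context, with $\lambda=1/2$ and $\bar u_0\ne0$. Assume that the exact admissible rescaled solution exists for every $t\ge0$, remains in the stability ball ($\mathfrak E_k(t)<\delta_*$ for all $t\ge 0$), and satisfies the modulation bounds throughout. Assume in addition that, for some $\gamma_u>0$, $$c_u(t)\le-\gamma_u<0\qquad\text{for all }t\ge0 .$$ Then: (i) the physical time $\mathring t(t)$ converges, as $t\to\infty$, to a finite limit $T$, and $$0<T-\mathring t(t)\le\frac{e^{-\gamma_ut}}{\gamma_u\,\mathrm s_u(0)}\qquad\text{for all }t\ge 0;$$ (ii) the traveling center $\mathring z_c(t)$ converges to a finite physical location; (iii) at the moving center the physical axial vorticity satisfies $$\big|\omega^z\big(0,\mathring z_c(t),\mathring t(t)\big)\big|=2|\bar u_0|\,\mathrm s_u(t)\longrightarrow\infty\qquad(t\to\infty);$$ (iv) consequently $\|\tilde\omega(\cdot,\mathring t(t))\|_{L^\infty(\mathbb R^3)}\to\infty$, and the reconstructed physical solution cannot be continued smoothly through $T$ (there is no $\epsilon>0$ and smooth solution of the Euler equations on $\mathbb R^3\times[\mathring t(0),T+\epsilon)$ that agrees with it for times less than $T$).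
   Context: Physical variables. $\tilde u$ is a smooth axisymmetric solution of the 3D incompressible Euler equations, with cylindrical coordinates $(\mathring r,\theta,\mathring z)$, swirl component $u^\theta$, vorticity $\tilde\omega=\nabla\times\tilde u$ with axial component $\omega^z=\frac1{\mathring r}\partial_{\mathring r}(\mathring r u^\theta)$. Reduced variables: $u_\bullet=u^\theta/\mathring r$, $\omega_\bullet=\omega^\theta/\mathring r$, $\psi_\bullet=\psi^\theta/\mathring r$ (where $\psi^\theta$ is the azimuthal component of the vector streamfunction), smooth and even in $\mathring r$ up to the axis; physical time is $\mathring t$. They satisfy, with $u^r_{\rm ph}=-\mathring r\,\partial_{\mathring z}\psi_\bullet$ and $u^z_{\rm ph}=2\psi_\bullet+\mathring r\,\partial_{\mathring r}\psi_\bullet$, $\partial_{\mathring t}u_\bullet+u^r_{\rm ph}\partial_{\mathring r}u_\bullet+u^z_{\rm ph}\partial_{\mathring z}u_\bullet=2u_\bullet\partial_{\mathring z}\psi_\bullet$, $\ \partial_{\mathring t}\omega_\bullet+u^r_{\rm ph}\partial_{\mathring r}\omega_\bullet+u^z_{\rm ph}\partial_{\mathring z}\omega_\bullet=2u_\bullet\partial_{\mathring z}u_\bullet$, $\ -(\partial_{\mathring r}^2+\frac3{\mathring r}\partial_{\mathring r}+\partial_{\mathring z}^2)\psi_\bullet=\omega_\bullet$. Dynamic rescaling. The rescaled time is $t$; $\mathrm s_r,\mathrm s_u,\mathrm s_\omega>0$ are functions of $t$, $\mathring z_c(t)$ is the axial center, and $\mathring r=\mathrm s_r(t)r$, $\mathring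 z-\mathring z_c(t)=\mathrm s_r(t)z$, $u_\bullet(\mathring r,\mathring z,\mathring t)=\mathrm s_u(t)u(r,z,t)$, $\omega_\bullet=\mathrm s_\omega(t)\omega(r,z,t)$, $\psi_\bullet=\mathrm s_\omega(t)\mathrm s_r(t)^2\psi(r,z,t)$, with $\mathrm s_u=\mathrm s_\omega\mathrm s_r$, $\frac{dt}{d\mathring t}=\mathrm s_\omega\mathrm s_r$ (so $\frac{d\mathring t}{dt}=1/\mathrm s_u$), and rates defined by $\partial_t\mathrm s_r=-\lambda\mathrm s_r$, $\partial_t\mathrm s_u=-c_u(t)\mathrm s_u$, $\partial_t\mathrm s_\omega=-c_\omega(t)\mathrm s_\omega$, $\partial_t\mathring z_c=-C(t)\mathrm s_r$ (so $c_\omega=c_u-\lambda$). The rescaled solution satisfies $\partial_tu+(\lambda r+u^r)\partial_ru+(\lambda z+C+u^z)\partial_zu=2u\,\partial_z\psi+c_uu$, $\ \partial_t\omega+(\lambda r+u^r)\partial_r\omega+(\lambda z+C+u^z)\partial_z\omega=2u\,\partial_zu+c_\omega\omega$, $\ -(\partial_r^2+\frac3r\partial_r+\partial_z^2)\psi=\omega$, with $u^r=-r\partial_z\psi$, $u^z=2\psi+r\partial_r\psi$, together with the normalization conditions $C(t)+u^z(0,0,t)=0$ and $u(0,0,t)=\bar u_0$ for all $t$. Reference profile and stability ball. $(\bar u,\bar\omega,\bar\psi,\bar C,\bar c_u)$ is a fixed (approximate) steady profile with $\bar u_0=\bar u(0,0)\ne0$, and $c_{u,\mathrm{res}}$ is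 a fixed real constant. Perturbations: $\delta u=u-\bar u$, $\delta\omega=\omega-\bar\omega$, $\delta C=C-\bar C$, $\delta c_u=c_u-\bar c_u-c_{u,\mathrm{res}}$; $\delta v_\omega=\delta\omega$, $\delta v_r=\partial_r\delta u$, $\delta v_z=\partial_z\delta u$. For fixed positive weights $\Phi_\omega,\Phi_r,\Phi_z$ on the half-plane $\mathbb D=\{r\ge0,z\in\mathbb R\}$, bounded below by a positive constant, and $\rho=r^2+z^2$, $\Phi_{i,k}=1+\rho^k\Phi_i$, the energy is $\mathfrak E_k^2=\sum_{i}\int_{\mathbb D}|\delta v_i|^2\Phi_i\,dr\,dz+\mu_k\sum_i\sum_{|\alpha|=k}\int_{\mathbb D}|D^\alpha\delta v_i|^2\Phi_{i,k}\,dr\,dz$ with $i\in\{\omega,r,z\}$, $k\ge4$ and $\mu_k>0$ fixed. The stability ball is $\{\mathfrak E_k<\delta_*\}$ for a fixed $\delta_*>0$. The modulation bounds are bounds $|\delta C(t)|\le M_C\,\mathfrak E_k(t)$ and $|\delta c_u(t)|\le M_{c_u}\mathfrak E_k(t)$ with finite constants $M_C,M_{c_u}$; in particular $C(t)$ is bounded on $[0,\infty)$. "Admissible" means smooth, even in $r$, decaying at infinity, with finite energy; the modulation functions are continuous in $t$. *)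

theory Defs
  imports "HOL-Analysis.Analysis" "HOL-Probability.Essential_Supremum"
begin

(* Smoothness on sets that need not be open, such as [a,b) x R^3: the derivatives are taken within
   the set.  All sets used below are products of intervals with nonempty interior, so that the
   derivative within the set is unique and one-sided derivatives occur exactly at the boundary. *)

primrec Ck_on :: "nat \<Rightarrow> 'a::euclidean_space set \<Rightarrow> ('a \<Rightarrow> 'b::real_normed_vector) \<Rightarrow> bool" where
  "Ck_on 0 S f \<longleftrightarrow> continuous_on S f"
| "Ck_on (Suc n) S f \<longleftrightarrow> f differentiable_on S \<and>
     (\<forall>b\<in>Basis. Ck_on n S (\<lambda>x. frechet_derivative f (at x within S) b))"

definition smooth_on :: "'a::euclidean_space set \<Rightarrow> ('a \<Rightarrow> 'b::real_normed_vector) \<Rightarrow> bool" where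
  "smooth_on S f \<longleftrightarrow> (\<forall>n. Ck_on n S f)"

section \<open>The Euler equations on three-dimensional space\<close>

definition partial :: "3 \<Rightarrow> (real^3 \<Rightarrow> 'b::real_normed_vector) \<Rightarrow> real^3 \<Rightarrow> 'b" where
  "partial j f x = frechet_derivative f (at x) (axis j 1)"

definition gradient :: "(real^3 \<Rightarrow> real) \<Rightarrow> real^3 \<Rightarrow> real^3" where
  "gradient p x = (\<chi> j. partial j p x)"

definition divergence :: "(real^3 \<Rightarrow> real^3) \<Rightarrow> real^3 \<Rightarrow> real" where
  "divergence v x = (\<Sum>j\<in>UNIV. partial j v x $ j)"

definition curl :: "(real^3 \<Rightarrow> real^3) \<Rightarrow> real^3 \<Rightarrow> real^3" where
  "curl v x = vector [partial 2 v x $ 3 - partial 3 v x $ 2,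
                      partial 3 v x $ 1 - partial 1 v x $ 3,
                      partial 1 v x $ 2 - partial 2 v x $ 1]"

definition smooth_euler_solution :: "real set \<Rightarrow> (real \<Rightarrow> real^3 \<Rightarrow> real^3) \<Rightarrow> bool" where
  "smooth_euler_solution J v \<longleftrightarrow>
     smooth_on (J \<times> UNIV) (\<lambda>(t, x). v t x) \<and>
     (\<exists>p :: real \<Rightarrow> real^3 \<Rightarrow> real.
        smooth_on (J \<times> UNIV) (\<lambda>(t, x). p t x) \<and>
        (\<forall>t\<in>J. \<forall>x.
           vector_derivative (\<lambda>s. v s x) (at t within J)
             + (\<Sum>j\<in>UNIV. v t x $ j *\<^sub>R partial j (v t) x) + gradient (p t) x = 0 \<and>
           divergence (v t) x = 0))"

definition Linf_norm :: "(real^3 \<Rightarrow> real^3) \<Rightarrow> ereal" where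
  "Linf_norm f = esssup lborel (\<lambda>x. ereal (norm (f x)))"

section \<open>Cylindrical coordinates\<close>

definition cyl :: "real \<Rightarrow> real \<Rightarrow> real \<Rightarrow> real^3" where
  "cyl r \<theta> z = vector [r * cos \<theta>, r * sin \<theta>, z]"

definition e_rad :: "real \<Rightarrow> real^3" where
  "e_rad \<theta> = vector [cos \<theta>, sin \<theta>, 0]"

definition e_azi :: "real \<Rightarrow> real^3" where
  "e_azi \<theta> = vector [- sin \<theta>, cos \<theta>, 0]"

definition e_axi :: "real^3" where
  "e_axi = vector [0, 0, 1]"

definition axisymmetric :: "(real^3 \<Rightarrow> real^3) \<Rightarrow> bool" where
  "axisymmetric v \<longleftrightarrow> (\<forall>r>0. \<forall>\<theta> z.
     v (cyl r \<theta> z) \<bullet> e_rad \<theta> = v (cyl r 0 z) \<bullet> e_rad 0 \<and>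
     v (cyl r \<theta> z) \<bullet> e_azi \<theta> = v (cyl r 0 z) \<bullet> e_azi 0 \<and>
     v (cyl r \<theta> z) \<bullet> e_axi = v (cyl r 0 z) \<bullet> e_axi)"

(* Components of an axisymmetric field, as functions of (r, z), read off on the half-plane of
   azimuth 0. *)

definition rad_comp :: "(real^3 \<Rightarrow> real^3) \<Rightarrow> real \<Rightarrow> real \<Rightarrow> real" where
  "rad_comp v r z = v (cyl r 0 z) \<bullet> e_rad 0"

definition azi_comp :: "(real^3 \<Rightarrow> real^3) \<Rightarrow> real \<Rightarrow> real \<Rightarrow> real" where
  "azi_comp v r z = v (cyl r 0 z) \<bullet> e_azi 0"

definition axi_comp :: "(real^3 \<Rightarrow> real^3) \<Rightarrow> real \<Rightarrow> real \<Rightarrow> real" where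
  "axi_comp v r z = v (cyl r 0 z) \<bullet> e_axi"

section \<open>The reduced axisymmetric system\<close>

(* Reduced variables are written as functions of (r, z, t) with r ranging over the whole real line;
   "smooth and even in r up to the axis" is smoothness of this even function. *)

definition pd_r :: "(real \<Rightarrow> real \<Rightarrow> real) \<Rightarrow> real \<Rightarrow> real \<Rightarrow> real" where
  "pd_r f r z = deriv (\<lambda>r'. f r' z) r"

definition pd_z :: "(real \<Rightarrow> real \<Rightarrow> real) \<Rightarrow> real \<Rightarrow> real \<Rightarrow> real" where
  "pd_z f r z = deriv (\<lambda>z'. f r z') z"

definition at_time :: "(real \<Rightarrow> real \<Rightarrow> real \<Rightarrow> real) \<Rightarrow> real \<Rightarrow> real \<Rightarrow> real \<Rightarrow> real" where
  "at_time f t r z = f r z t"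

definition smooth_even :: "real set \<Rightarrow> (real \<Rightarrow> real \<Rightarrow> real \<Rightarrow> real) \<Rightarrow> bool" where
  "smooth_even J f \<longleftrightarrow> smooth_on (UNIV \<times> UNIV \<times> J) (\<lambda>(r, z, t). f r z t) \<and>
     (\<forall>r z. \<forall>t\<in>J. f (- r) z t = f r z t)"

definition vel_r :: "(real \<Rightarrow> real \<Rightarrow> real) \<Rightarrow> real \<Rightarrow> real \<Rightarrow> real" where
  "vel_r \<psi> r z = - r * pd_z \<psi> r z"

definition vel_z :: "(real \<Rightarrow> real \<Rightarrow> real) \<Rightarrow> real \<Rightarrow> real \<Rightarrow> real" where
  "vel_z \<psi> r z = 2 * \<psi> r z + r * pd_r \<psi> r z"

(* The rescaled equations with dilation rate lam, axial drift C and damping rates cu, cw.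
   The physical equations are the case in which all four vanish. *)

definition reduced_system ::
  "real set \<Rightarrow> real \<Rightarrow> (real \<Rightarrow> real) \<Rightarrow> (real \<Rightarrow> real) \<Rightarrow> (real \<Rightarrow> real) \<Rightarrow>
   (real \<Rightarrow> real \<Rightarrow> real \<Rightarrow> real) \<Rightarrow> (real \<Rightarrow> real \<Rightarrow> real \<Rightarrow> real) \<Rightarrow>
   (real \<Rightarrow> real \<Rightarrow> real \<Rightarrow> real) \<Rightarrow> bool" where
  "reduced_system J lam C cu cw u \<omega> \<psi> \<longleftrightarrow>
    (\<forall>t\<in>J. \<forall>r\<ge>0. \<forall>z.
       vector_derivative (u r z) (at t within J)
         + (lam * r + vel_r (at_time \<psi> t) r z) * pd_r (at_time u t) r z
         + (lam * z + C t + vel_z (at_time \<psi> t) r z) * pd_z (at_time u t) r z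
       = 2 * u r z t * pd_z (at_time \<psi> t) r z + cu t * u r z t \<and>
       vector_derivative (\<omega> r z) (at t within J)
         + (lam * r + vel_r (at_time \<psi> t) r z) * pd_r (at_time \<omega> t) r z
         + (lam * z + C t + vel_z (at_time \<psi> t) r z) * pd_z (at_time \<omega> t) r z
       = 2 * u r z t * pd_z (at_time u t) r z + cw t * \<omega> r z t) \<and>
    (\<forall>t\<in>J. \<forall>r>0. \<forall>z.
       - (pd_r (pd_r (at_time \<psi> t)) r z + 3 / r * pd_r (at_time \<psi> t) r z
            + pd_z (pd_z (at_time \<psi> t)) r z) = \<omega> r z t)"

(* The azimuthal stream function r * psib enters through the radial and axial velocities that it
   generates. *)

definition physical_solution ::
  "real set \<Rightarrow> (real \<Rightarrow> real^3 \<Rightarrow> real^3) \<Rightarrow> (real \<Rightarrow> real \<Rightarrow> real \<Rightarrow> real) \<Rightarrow>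
   (real \<Rightarrow> real \<Rightarrow> real \<Rightarrow> real) \<Rightarrow> (real \<Rightarrow> real \<Rightarrow> real \<Rightarrow> real) \<Rightarrow> bool" where
  "physical_solution J v ub \<omega>b \<psi>b \<longleftrightarrow>
     smooth_euler_solution J v \<and> (\<forall>t\<in>J. axisymmetric (v t)) \<and>
     smooth_even J ub \<and> smooth_even J \<omega>b \<and> smooth_even J \<psi>b \<and>
     (\<forall>t\<in>J. \<forall>r>0. \<forall>z.
        ub r z t = azi_comp (v t) r z / r \<and>
        \<omega>b r z t = azi_comp (curl (v t)) r z / r \<and>
        rad_comp (v t) r z = vel_r (at_time \<psi>b t) r z \<and>
        axi_comp (v t) r z = vel_z (at_time \<psi>b t) r z) \<and>
     reduced_system J 0 (\<lambda>_. 0) (\<lambda>_. 0) (\<lambda>_. 0) ub \<omega>b \<psi>b"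

section \<open>Dynamic rescaling\<close>

(* sr, su, sw: scales; zc: axial centre; tp: physical time, all as functions of rescaled time. *)

definition rescaling_rates ::
  "real \<Rightarrow> (real \<Rightarrow> real) \<Rightarrow> (real \<Rightarrow> real) \<Rightarrow> (real \<Rightarrow> real) \<Rightarrow> (real \<Rightarrow> real) \<Rightarrow>
   (real \<Rightarrow> real) \<Rightarrow> (real \<Rightarrow> real) \<Rightarrow> (real \<Rightarrow> real) \<Rightarrow> (real \<Rightarrow> real) \<Rightarrow> bool" where
  "rescaling_rates lam C cu cw sr su sw zc tp \<longleftrightarrow>
     (\<forall>t\<ge>0. sr t > 0 \<and> su t > 0 \<and> sw t > 0 \<and> su t = sw t * sr t \<and>
        (sr has_real_derivative - lam * sr t) (at t within {0..}) \<and>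
        (su has_real_derivative - cu t * su t) (at t within {0..}) \<and>
        (sw has_real_derivative - cw t * sw t) (at t within {0..}) \<and>
        (zc has_real_derivative - C t * sr t) (at t within {0..}) \<and>
        (tp has_real_derivative 1 / su t) (at t within {0..}))"

definition rescaled_variables ::
  "(real \<Rightarrow> real) \<Rightarrow> (real \<Rightarrow> real) \<Rightarrow> (real \<Rightarrow> real) \<Rightarrow> (real \<Rightarrow> real) \<Rightarrow> (real \<Rightarrow> real) \<Rightarrow>
   (real \<Rightarrow> real \<Rightarrow> real \<Rightarrow> real) \<Rightarrow> (real \<Rightarrow> real \<Rightarrow> real \<Rightarrow> real) \<Rightarrow>
   (real \<Rightarrow> real \<Rightarrow> real \<Rightarrow> real) \<Rightarrow> (real \<Rightarrow> real \<Rightarrow> real \<Rightarrow> real) \<Rightarrow>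
   (real \<Rightarrow> real \<Rightarrow> real \<Rightarrow> real) \<Rightarrow> (real \<Rightarrow> real \<Rightarrow> real \<Rightarrow> real) \<Rightarrow> bool" where
  "rescaled_variables sr su sw zc tp ub \<omega>b \<psi>b u \<omega> \<psi> \<longleftrightarrow>
     (\<forall>t\<ge>0. \<forall>r\<ge>0. \<forall>z.
        ub (sr t * r) (zc t + sr t * z) (tp t) = su t * u r z t \<and>
        \<omega>b (sr t * r) (zc t + sr t * z) (tp t) = sw t * \<omega> r z t \<and>
        \<psi>b (sr t * r) (zc t + sr t * z) (tp t) = sw t * (sr t)\<^sup>2 * \<psi> r z t)"

section \<open>The energy\<close>

definition half_plane :: "(real \<times> real) set" where
  "half_plane = {(r, z). r \<ge> 0}"

datatype pert = PertW | PertR | PertZ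

fun pert_field ::
  "(real \<Rightarrow> real \<Rightarrow> real) \<Rightarrow> (real \<Rightarrow> real \<Rightarrow> real) \<Rightarrow> pert \<Rightarrow> real \<Rightarrow> real \<Rightarrow> real" where
  "pert_field du dw PertW = dw"
| "pert_field du dw PertR = pd_r du"
| "pert_field du dw PertZ = pd_z du"

definition admissible_weight :: "(real \<Rightarrow> real \<Rightarrow> real) \<Rightarrow> bool" where
  "admissible_weight \<Phi> \<longleftrightarrow> (\<lambda>(r, z). \<Phi> r z) \<in> borel_measurable borel \<and>
     (\<exists>c>0. \<forall>(r, z)\<in>half_plane. c \<le> \<Phi> r z)"

(* Computed in ennreal, so that an infinite energy is not confused with a small one. *)

definition energy_sq ::
  "nat \<Rightarrow> real \<Rightarrow> (pert \<Rightarrow> real \<Rightarrow> real \<Rightarrow> real) \<Rightarrow>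
   (real \<Rightarrow> real \<Rightarrow> real) \<Rightarrow> (real \<Rightarrow> real \<Rightarrow> real) \<Rightarrow> ennreal" where
  "energy_sq k \<mu> \<Phi> du dw =
     (\<Sum>i\<in>{PertW, PertR, PertZ}. \<integral>\<^sup>+ x \<in> half_plane.
        (case x of (r, z) \<Rightarrow> ennreal (\<bar>pert_field du dw i r z\<bar>\<^sup>2 * \<Phi> i r z)) \<partial>lborel)
     + ennreal \<mu> * (\<Sum>i\<in>{PertW, PertR, PertZ}. \<Sum>(a, b)\<in>{(a, b). a + b = k}.
        \<integral>\<^sup>+ x \<in> half_plane.
          (case x of (r, z) \<Rightarrow>
             ennreal (\<bar>(pd_r ^^ a) ((pd_z ^^ b) (pert_field du dw i)) r z\<bar>\<^sup>2
                      * (1 + (r\<^sup>2 + z\<^sup>2) ^ k * \<Phi> i r z))) \<partial>lborel)"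

definition energy ::
  "nat \<Rightarrow> real \<Rightarrow> (pert \<Rightarrow> real \<Rightarrow> real \<Rightarrow> real) \<Rightarrow>
   (real \<Rightarrow> real \<Rightarrow> real) \<Rightarrow> (real \<Rightarrow> real \<Rightarrow> real) \<Rightarrow> real" where
  "energy k \<mu> \<Phi> du dw = sqrt (enn2real (energy_sq k \<mu> \<Phi> du dw))"

definition decaying :: "(real \<Rightarrow> real \<Rightarrow> real) \<Rightarrow> bool" where
  "decaying f \<longleftrightarrow> ((\<lambda>(r, z). f r z) \<longlongrightarrow> 0) at_infinity"

definition deviation ::
  "(real \<Rightarrow> real \<Rightarrow> real \<Rightarrow> real) \<Rightarrow> (real \<Rightarrow> real \<Rightarrow> real) \<Rightarrow> real \<Rightarrow> real \<Rightarrow> real \<Rightarrow> real" where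
  "deviation f fbar t r z = f r z t - fbar r z"

definition admissible_rescaled_solution ::
  "real \<Rightarrow> (real \<Rightarrow> real) \<Rightarrow> (real \<Rightarrow> real) \<Rightarrow> (real \<Rightarrow> real) \<Rightarrow>
   (real \<Rightarrow> real \<Rightarrow> real \<Rightarrow> real) \<Rightarrow> (real \<Rightarrow> real \<Rightarrow> real \<Rightarrow> real) \<Rightarrow>
   (real \<Rightarrow> real \<Rightarrow> real \<Rightarrow> real) \<Rightarrow>
   (real \<Rightarrow> real \<Rightarrow> real) \<Rightarrow> (real \<Rightarrow> real \<Rightarrow> real) \<Rightarrow>
   nat \<Rightarrow> real \<Rightarrow> (pert \<Rightarrow> real \<Rightarrow> real \<Rightarrow> real) \<Rightarrow> bool" where
  "admissible_rescaled_solution lam C cu cw u \<omega> \<psi> ubar \<omega>bar k \<mu> \<Phi> \<longleftrightarrow>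
     smooth_even {0..} u \<and> smooth_even {0..} \<omega> \<and> smooth_even {0..} \<psi> \<and>
     continuous_on {0..} C \<and> continuous_on {0..} cu \<and> continuous_on {0..} cw \<and>
     reduced_system {0..} lam C cu cw u \<omega> \<psi> \<and>
     (\<forall>t\<ge>0.
        decaying (at_time u t) \<and> decaying (at_time \<omega> t) \<and> decaying (at_time \<psi> t) \<and>
        energy_sq k \<mu> \<Phi> (deviation u ubar t) (deviation \<omega> \<omega>bar t) < \<infinity> \<and>
        C t + vel_z (at_time \<psi> t) 0 0 = 0 \<and>
        u 0 0 t = ubar 0 0)"

end

(* On the axis the axial vorticity is twice the reduced swirl, and the normalization of u at the
   origin makes this 2 * ubar 0 0 * su t at the moving centre. Since su grows at least like
   exp (gamma * t), the physical time 1/su is integrable, while zc has a speed of order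
   exp (- t / 2). A smooth continuation would have vorticity continuous at the limit point
   (Z, T), although it is unbounded along the path of the centre. *)
theory Submission
  imports Defs
begin

section \<open>Monotonicity and limits on the half line\<close>

text \<open>The rates are derivatives within \<open>{0..}\<close>, one-sided at 0. Restricting them
  to \<open>{s..t}\<close> brings the mean value theorem into play; of the location of
  \<open>\<xi>\<close> only the lower bound is kept, which places it where the sign of
  \<open>f'\<close> is known.\<close>

lemma mvt_half_line:
  fixes f f' :: "real \<Rightarrow> real"
  assumes "\<And>x. x \<ge> 0 \<Longrightarrow> (f has_real_derivative f' x) (at x within {0..})" "0 \<le> s" "s \<le> t"
  shows "\<exists>\<xi>\<ge>s. f t - f s = f' \<xi> * (t - s)"
proof -
  have "(f has_derivative (*) (f' x)) (at x within {s..t})" if "s \<le> x" for x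
    using assms(1)[of x] that \<open>0 \<le> s\<close> unfolding has_field_derivative_def
    by (rule_tac has_derivative_subset) auto
  then show ?thesis
    using mvt_very_simple[OF \<open>s \<le> t\<close>, of f "\<lambda>x. (*) (f' x)"] by force
qed

lemma nonneg_derivative_mono_half_line:
  fixes f f' :: "real \<Rightarrow> real"
  assumes "\<And>x. x \<ge> 0 \<Longrightarrow> (f has_real_derivative f' x) (at x within {0..})"
    and "\<And>x. x \<ge> 0 \<Longrightarrow> f' x \<ge> 0" and "0 \<le> s" "s \<le> t"
  shows "f s \<le> f t"
proof -
  obtain \<xi> where "\<xi> \<ge> s" "f t - f s = f' \<xi> * (t - s)"
    using mvt_half_line[OF assms(1) assms(3,4)] by blast
  moreover have "f' \<xi> * (t - s) \<ge> 0"
    using assms(2)[of \<xi>] \<open>\<xi> \<ge> s\<close> assms(3,4) by simp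
  ultimately show ?thesis by linarith
qed

lemma pos_derivative_strict_mono_half_line:
  fixes f f' :: "real \<Rightarrow> real"
  assumes "\<And>x. x \<ge> 0 \<Longrightarrow> (f has_real_derivative f' x) (at x within {0..})"
    and "\<And>x. x \<ge> 0 \<Longrightarrow> f' x > 0" and "0 \<le> s" "s < t"
  shows "f s < f t"
proof -
  obtain \<xi> where "\<xi> \<ge> s" "f t - f s = f' \<xi> * (t - s)"
    using mvt_half_line[OF assms(1) assms(3)] \<open>s < t\<close> by (meson less_imp_le)
  moreover have "f' \<xi> * (t - s) > 0"
    using assms(2)[of \<xi>] \<open>\<xi> \<ge> s\<close> assms(3,4) by simp
  ultimately show ?thesis by linarith
qed

text \<open>The limit is the supremum over \<open>{0..}\<close>, so it bounds \<open>f\<close> at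
  every time and not merely eventually.\<close>

lemma bounded_mono_half_line_tendsto:
  fixes f :: "real \<Rightarrow> real"
  assumes mono: "\<And>s t. 0 \<le> s \<Longrightarrow> s \<le> t \<Longrightarrow> f s \<le> f t"
    and bdd: "\<And>t. t \<ge> 0 \<Longrightarrow> f t \<le> B"
  obtains L where "(f \<longlongrightarrow> L) at_top" "\<And>t. t \<ge> 0 \<Longrightarrow> f t \<le> L"
proof
  have bdd': "bdd_above (f ` {0..})"
    using bdd by (auto intro!: bdd_aboveI)
  show le: "f t \<le> (SUP s\<in>{0..}. f s)" if "t \<ge> 0" for t
    using that by (intro cSUP_upper bdd') auto
  show "(f \<longlongrightarrow> (SUP s\<in>{0..}. f s)) at_top"
  proof (rule increasing_tendsto)
    show "\<forall>\<^sub>F t in at_top. f t \<le> (SUP s\<in>{0..}. f s)"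
      using eventually_ge_at_top[of 0] by eventually_elim (rule le)
    fix x assume "x < (SUP s\<in>{0..}. f s)"
    then obtain s where "s \<ge> 0" "x < f s"
      using less_cSUP_iff[of "{0..}" f x] bdd' by auto
    then show "\<forall>\<^sub>F t in at_top. x < f t"
      using eventually_ge_at_top[of s]
      by (elim eventually_mono) (use mono in \<open>force intro: less_le_trans\<close>)
  qed
qed

section \<open>Joint continuity of the vorticity in time and space\<close>

text \<open>Smoothness is stated within \<open>J \<times> UNIV\<close>, while \<open>partial\<close>
  and \<open>curl\<close> use unrestricted derivatives in space. Composing with
  \<open>Pair t\<close>, whose domain is all of space, removes the restriction, even when
  \<open>t\<close> is an endpoint of \<open>J\<close>.\<close>

lemma spatial_derivative:
  fixes v :: "real \<Rightarrow> real^3 \<Rightarrow> real^3"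
  assumes "smooth_on (J \<times> UNIV) (\<lambda>(t, x). v t x)" "t \<in> J"
  shows "(v t has_derivative
           (\<lambda>h. frechet_derivative (\<lambda>(t, x). v t x) (at (t, x) within J \<times> UNIV) (0, h))) (at x)"
proof -
  let ?F = "\<lambda>(t, x). v t x"
  have "Ck_on (Suc 0) (J \<times> UNIV) ?F"
    using assms(1) unfolding smooth_on_def by blast
  then have "?F differentiable (at (t, x) within J \<times> UNIV)"
    using \<open>t \<in> J\<close> by (simp add: differentiable_on_def)
  then have "(?F has_derivative frechet_derivative ?F (at (t, x) within J \<times> UNIV))
      (at (t, x) within J \<times> UNIV)"
    by (simp add: frechet_derivative_works)
  then have "(?F has_derivative frechet_derivative ?F (at (t, x) within J \<times> UNIV))
      (at (Pair t x) within range (Pair t))"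
    by (rule has_derivative_subset) (use \<open>t \<in> J\<close> in auto)
  moreover have "(Pair t has_derivative (\<lambda>h. (0, h))) (at x)"
    by (auto intro!: derivative_eq_intros)
  ultimately show ?thesis
    using has_derivative_in_compose[of "Pair t" "\<lambda>h. (0, h)" x UNIV ?F] by simp
qed

lemma partial_eq_spatial_derivative:
  fixes f :: "real^3 \<Rightarrow> 'b::real_normed_vector"
  assumes "(f has_derivative D) (at x)"
  shows "partial j f x = D (axis j 1)"
  unfolding partial_def using frechet_derivative_at[OF assms] by simp

text \<open>A spatial partial derivative is the joint derivative in the basis direction
  \<open>(0, axis j 1)\<close>, and the first level of \<open>Ck_on\<close> makes that continuous in
  both variables together.\<close>

lemma continuous_on_partial:
  fixes v :: "real \<Rightarrow> real^3 \<Rightarrow> real^3"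
  assumes "smooth_on (J \<times> UNIV) (\<lambda>(t, x). v t x)"
  shows "continuous_on (J \<times> UNIV) (\<lambda>y. partial j (v (fst y)) (snd y))"
proof -
  let ?F = "\<lambda>(t, x). v t x"
  have "Ck_on (Suc 0) (J \<times> UNIV) ?F"
    using assms unfolding smooth_on_def by blast
  moreover have "(0, axis j 1) \<in> (Basis :: (real \<times> (real^3)) set)"
    by (auto simp: Basis_prod_def Basis_vec_def)
  ultimately have "continuous_on (J \<times> UNIV)
      (\<lambda>y. frechet_derivative ?F (at y within J \<times> UNIV) (0, axis j 1))"
    by simp
  then show ?thesis
    by (rule continuous_on_eq)
       (auto simp: partial_eq_spatial_derivative[OF spatial_derivative[OF assms]])
qed

lemma continuous_on_curl:
  fixes v :: "real \<Rightarrow> real^3 \<Rightarrow> real^3"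
  assumes "smooth_on (J \<times> UNIV) (\<lambda>(t, x). v t x)"
  shows "continuous_on (J \<times> UNIV) (\<lambda>y. curl (v (fst y)) (snd y))"
proof -
  have "continuous_on (J \<times> UNIV) (\<lambda>y. curl (v (fst y)) (snd y) $ i)" for i
    using exhaust_3[of i]
    by (elim disjE; simp add: curl_def)
       (intro continuous_intros continuous_on_partial[OF assms])+
  then have "continuous_on (J \<times> UNIV) (\<lambda>y. \<chi> i. curl (v (fst y)) (snd y) $ i)"
    by (rule continuous_on_vec_lambda)
  then show ?thesis by simp
qed

section \<open>Vorticity on the axis of symmetry\<close>

text \<open>Continuity forces \<open>\<phi> 0 = 0\<close>, and then the right difference quotient of
  \<open>\<phi>\<close> at 0 is \<open>g\<close> itself. Only \<open>r > 0\<close> enters because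
  the swirl is divided by the radius.\<close>

lemma derivative_of_mult_at_zero:
  fixes \<phi> g :: "real \<Rightarrow> real"
  assumes deriv: "(\<phi> has_real_derivative d) (at 0)" and g: "(g \<longlongrightarrow> l) (at_right 0)"
    and eq: "\<And>r. r > 0 \<Longrightarrow> \<phi> r = r * g r"
  shows "d = l"
proof -
  have ev: "\<forall>\<^sub>F r::real in at_right 0. 0 < r"
    by (simp add: eventually_at_right_less)
  have "((\<lambda>r. r * g r) \<longlongrightarrow> 0 * l) (at_right 0)"
    by (intro tendsto_intros g)
  moreover have "(\<phi> \<longlongrightarrow> \<phi> 0) (at_right 0)"
    using DERIV_isCont[OF deriv] by (simp add: isCont_def filterlim_at_split)
  then have "((\<lambda>r. r * g r) \<longlongrightarrow> \<phi> 0) (at_right 0)"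
    by (rule Lim_transform_eventually) (use ev in \<open>eventually_elim, simp add: eq\<close>)
  ultimately have "\<phi> 0 = 0"
    using tendsto_unique trivial_limit_at_right_real by fastforce
  have "((\<lambda>r. (\<phi> r - \<phi> 0) / (r - 0)) \<longlongrightarrow> d) (at_right 0)"
    using deriv by (simp add: has_field_derivative_iff filterlim_at_split)
  then have "(g \<longlongrightarrow> d) (at_right 0)"
    by (rule Lim_transform_eventually)
       (use ev in \<open>eventually_elim, simp add: eq \<open>\<phi> 0 = 0\<close>\<close>)
  then show ?thesis
    using g tendsto_unique trivial_limit_at_right_real by blast
qed

text \<open>By axisymmetry the azimuthal component along every ray from the axis is
  \<open>r * g r\<close>, so its radial derivative on the axis is \<open>l\<close> at every azimuth.
  Azimuth 0 gives \<open>l\<close> for the first partial of component 2, azimuth \<open>pi/2\<close>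
  gives \<open>- l\<close> for the second partial of component 1; their difference is
  \<open>2 * l\<close>.\<close>

lemma axial_vorticity_on_axis:
  fixes f :: "real^3 \<Rightarrow> real^3"
  assumes D: "(f has_derivative D) (at (cyl 0 0 z))" and axi: "axisymmetric f"
    and g: "(g \<longlongrightarrow> l) (at_right 0)" and swirl: "\<And>r. r > 0 \<Longrightarrow> g r = azi_comp f r z / r"
  shows "axi_comp (curl f) 0 z = 2 * l"
proof -
  have azi: "D (e_rad \<theta>) \<bullet> e_azi \<theta> = l" for \<theta>
  proof -
    define \<phi> where "\<phi> r = f (cyl r \<theta> z) \<bullet> e_azi \<theta>" for r
    have cyl: "cyl r \<theta> z = cyl 0 0 z + r *\<^sub>R e_rad \<theta>" for r
      by (simp add: cyl_def e_rad_def vec_eq_iff forall_3)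
    have "((\<lambda>r. cyl r \<theta> z) has_derivative (\<lambda>h. h *\<^sub>R e_rad \<theta>)) (at 0)"
      unfolding cyl by (auto intro!: derivative_eq_intros)
    \<comment> \<open>All azimuths name the same point on the axis, so one derivative
      \<open>D\<close> serves every ray.\<close>
    moreover have "(f has_derivative D) (at (cyl 0 \<theta> z))"
      using D by (simp add: cyl)
    ultimately have "((\<lambda>r. f (cyl r \<theta> z)) has_derivative (\<lambda>h. D (h *\<^sub>R e_rad \<theta>))) (at 0)"
      by (rule has_derivative_compose)
    then have "(\<phi> has_derivative (\<lambda>h. D (h *\<^sub>R e_rad \<theta>) \<bullet> e_azi \<theta>)) (at 0)"
      unfolding \<phi>_def by (rule has_derivative_inner_left)
    moreover have "(\<lambda>h. D (h *\<^sub>R e_rad \<theta>) \<bullet> e_azi \<theta>) = (*) (D (e_rad \<theta>) \<bullet> e_azi \<theta>)"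
      using linear_scale[OF has_derivative_linear[OF D]] by auto
    ultimately have "(\<phi> has_real_derivative D (e_rad \<theta>) \<bullet> e_azi \<theta>) (at 0)"
      by (simp add: has_field_derivative_def)
    then show ?thesis
    proof (rule derivative_of_mult_at_zero[OF _ g])
      fix r :: real assume "r > 0"
      then have "\<phi> r = azi_comp f r z"
        using axi unfolding \<phi>_def axisymmetric_def azi_comp_def by blast
      then show "\<phi> r = r * g r"
        using swirl[OF \<open>r > 0\<close>] \<open>r > 0\<close> by simp
    qed
  qed
  have "e_rad 0 = axis 1 1" "e_rad (pi/2) = axis 2 1"
    by (simp_all add: e_rad_def vec_eq_iff forall_3 axis_def)
  then have "partial 1 f (cyl 0 0 z) \<bullet> e_azi 0 = l" "partial 2 f (cyl 0 0 z) \<bullet> e_azi (pi/2) = l"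
    using azi[of 0] azi[of "pi/2"] by (simp_all add: partial_eq_spatial_derivative[OF D])
  then show ?thesis
    by (simp add: axi_comp_def curl_def e_axi_def e_azi_def inner_vec_def sum_3)
qed

text \<open>A closed set of full Lebesgue measure is the whole space. This lets the value at the
  single moving centre, a null set, bound the essential supremum from below.\<close>

lemma continuous_le_Linf_norm:
  fixes f :: "real^3 \<Rightarrow> real^3"
  assumes f: "continuous_on UNIV f"
  shows "ereal (norm (f x)) \<le> Linf_norm f"
proof -
  have cont: "continuous_on UNIV (\<lambda>x. ereal (norm (f x)))"
    by (intro continuous_intros f)
  have "AE x in lborel. x \<in> {x. ereal (norm (f x)) \<le> Linf_norm f}"
    using esssup_AE[of "\<lambda>x. ereal (norm (f x))" lborel] by (simp add: Linf_norm_def)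
  then have "AE x in lebesgue. x \<in> {x. ereal (norm (f x)) \<le> Linf_norm f}"
    by (rule AE_completion)
  moreover have "closed {x. ereal (norm (f x)) \<le> Linf_norm f}"
    by (intro closed_Collect_le cont continuous_intros)
  ultimately show ?thesis
    using mem_closed_if_AE_lebesgue by blast
qed

theorem propositionS4:
  fixes v :: "real \<Rightarrow> real^3 \<Rightarrow> real^3"
    and ub \<omega>b \<psi>b u \<omega> \<psi> :: "real \<Rightarrow> real \<Rightarrow> real \<Rightarrow> real"
    and C cu cw sr su sw zc tp :: "real \<Rightarrow> real"
    and ubar \<omega>bar :: "real \<Rightarrow> real \<Rightarrow> real"
    and Cbar cubar cures \<mu> \<delta> MC Mcu \<gamma> :: real
    and \<Phi> :: "pert \<Rightarrow> real \<Rightarrow> real \<Rightarrow> real"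
    and k :: nat
  assumes profile: "ubar 0 0 \<noteq> 0"
    and weights: "\<And>i. admissible_weight (\<Phi> i)"
    and params: "k \<ge> 4" "\<mu> > 0" "\<delta> > 0"
    and rates: "rescaling_rates (1/2) C cu cw sr su sw zc tp"
    and rescaled: "admissible_rescaled_solution (1/2) C cu cw u \<omega> \<psi> ubar \<omega>bar k \<mu> \<Phi>"
    and physical: "physical_solution (tp ` {0..}) v ub \<omega>b \<psi>b"
    and variables: "rescaled_variables sr su sw zc tp ub \<omega>b \<psi>b u \<omega> \<psi>"
    and ball: "\<And>t. t \<ge> 0 \<Longrightarrow> energy k \<mu> \<Phi> (deviation u ubar t) (deviation \<omega> \<omega>bar t) < \<delta>"
    and bound_C: "\<And>t. t \<ge> 0 \<Longrightarrow>
        \<bar>C t - Cbar\<bar> \<le> MC * energy k \<mu> \<Phi> (deviation u ubar t) (deviation \<omega> \<omega>bar t)"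
    and bound_cu: "\<And>t. t \<ge> 0 \<Longrightarrow>
        \<bar>cu t - cubar - cures\<bar> \<le> Mcu * energy k \<mu> \<Phi> (deviation u ubar t) (deviation \<omega> \<omega>bar t)"
    and gamma: "\<gamma> > 0" "\<And>t. t \<ge> 0 \<Longrightarrow> cu t \<le> - \<gamma>"
  shows "\<exists>T.
      (tp \<longlongrightarrow> T) at_top \<and>
      (\<forall>t\<ge>0. 0 < T - tp t \<and> T - tp t \<le> exp (- \<gamma> * t) / (\<gamma> * su 0)) \<and>
      (\<exists>Z. (zc \<longlongrightarrow> Z) at_top) \<and>
      (\<forall>t\<ge>0. \<bar>axi_comp (curl (v (tp t))) 0 (zc t)\<bar> = 2 * \<bar>ubar 0 0\<bar> * su t) \<and>
      filterlim (\<lambda>t. \<bar>axi_comp (curl (v (tp t))) 0 (zc t)\<bar>) at_top at_top \<and>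
      ((\<lambda>t. Linf_norm (curl (v (tp t)))) \<longlongrightarrow> \<infinity>) at_top \<and>
      \<not> (\<exists>\<epsilon>>0. \<exists>w. smooth_euler_solution {tp 0..<T + \<epsilon>} w \<and>
            (\<forall>t\<in>{tp 0..<T}. \<forall>x. w t x = v t x))"
proof -
  have pos: "sr t > 0" "su t > 0"
    and dsr: "(sr has_real_derivative - (1/2) * sr t) (at t within {0..})"
    and dsu: "(su has_real_derivative - cu t * su t) (at t within {0..})"
    and dzc: "(zc has_real_derivative - C t * sr t) (at t within {0..})"
    and dtp: "(tp has_real_derivative 1 / su t) (at t within {0..})" if "t \<ge> 0" for t
    using rates that unfolding rescaling_rates_def by blast+

  \<comment> \<open>Exponential growth of the swirl scale\<close>
  have su_ge: "su t \<ge> su 0 * exp (\<gamma> * t)" if "t \<ge> 0" for t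
  proof -
    \<comment> \<open>The integrating factor turns the bound on \<open>cu\<close> into monotonicity:
      the product has logarithmic derivative \<open>- cu t - \<gamma>\<close>, which is
      nonnegative.\<close>
    have "su 0 * exp (- \<gamma> * 0) \<le> su t * exp (- \<gamma> * t)"
    proof (rule nonneg_derivative_mono_half_line[where f = "\<lambda>t. su t * exp (- \<gamma> * t)"
        and f' = "\<lambda>t. (- cu t - \<gamma>) * su t * exp (- \<gamma> * t)"])
      fix x :: real assume "x \<ge> 0"
      show "((\<lambda>t. su t * exp (- \<gamma> * t)) has_real_derivative
          (- cu x - \<gamma>) * su x * exp (- \<gamma> * x)) (at x within {0..})"
        by (rule derivative_eq_intros dsu[OF \<open>x \<ge> 0\<close>] refl | simp add: algebra_simps)+
      show "(- cu x - \<gamma>) * su x * exp (- \<gamma> * x) \<ge> 0"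
        using gamma(2)[OF \<open>x \<ge> 0\<close>] pos(2)[OF \<open>x \<ge> 0\<close>] by simp
    qed (use that in auto)
    then show ?thesis by (simp add: exp_minus field_simps)
  qed
  have su_top: "filterlim su at_top at_top"
  proof (rule filterlim_at_top_mono)
    show "filterlim (\<lambda>t. su 0 * exp (\<gamma> * t)) at_top at_top"
      using pos(2)[of 0] gamma(1)
      by (intro filterlim_tendsto_pos_mult_at_top[OF tendsto_const]
          filterlim_compose[OF exp_at_top] filterlim_ident) auto
    show "\<forall>\<^sub>F t in at_top. su 0 * exp (\<gamma> * t) \<le> su t"
      using eventually_ge_at_top[of 0] by eventually_elim (rule su_ge)
  qed

  \<comment> \<open>Finite limit of the physical time\<close>
  have tp_less: "tp s < tp t" if "0 \<le> s" "s < t" for s t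
    by (rule pos_derivative_strict_mono_half_line[where f' = "\<lambda>t. 1 / su t"])
       (use dtp pos(2) that in auto)
  then have tp_le: "tp s \<le> tp t" if "0 \<le> s" "s \<le> t" for s t
    using that by (cases "s = t") (auto intro: less_imp_le)
  \<comment> \<open>The added term is the integral of \<open>exp (- \<gamma> * s) / su 0\<close>
    over \<open>s \<ge> t\<close>, which dominates the remaining physical time. Hence
    \<open>G\<close> decreases and stays above \<open>tp\<close>, giving both the existence of
    \<open>T\<close> and the rate.\<close>
  define G where "G t = tp t + exp (- \<gamma> * t) / (\<gamma> * su 0)" for t
  have G_mono: "- G s \<le> - G t" if "0 \<le> s" "s \<le> t" for s t
  proof (rule nonneg_derivative_mono_half_line[where f = "\<lambda>t. - G t"
        and f' = "\<lambda>t. exp (- \<gamma> * t) / su 0 - 1 / su t"])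
    fix x :: real assume "x \<ge> 0"
    show "((\<lambda>t. - G t) has_real_derivative exp (- \<gamma> * x) / su 0 - 1 / su x) (at x within {0..})"
      unfolding G_def using gamma(1) pos(2)[of 0]
      by (auto intro!: derivative_eq_intros dtp[OF \<open>x \<ge> 0\<close>] simp: field_simps)
    show "0 \<le> exp (- \<gamma> * x) / su 0 - 1 / su x"
      using su_ge[OF \<open>x \<ge> 0\<close>] pos(2)[of 0] pos(2)[OF \<open>x \<ge> 0\<close>]
      by (simp add: exp_minus field_simps)
  qed (use that in auto)
  have tp_G: "tp t \<le> G t" for t
    using gamma(1) pos(2)[of 0] by (simp add: G_def)
  \<comment> \<open>The two are compared at the later of the times, where \<open>tp\<close> has
    grown and \<open>G\<close> has dropped.\<close>
  have tp_le_G: "tp s \<le> G t" if "0 \<le> t" "0 \<le> s" for s t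
    using G_mono[of t "max s t"] tp_G[of "max s t"] tp_le[of s "max s t"] that by linarith
  obtain T where T: "(tp \<longlongrightarrow> T) at_top" and tp_T: "\<And>t. t \<ge> 0 \<Longrightarrow> tp t \<le> T"
    using bounded_mono_half_line_tendsto[of tp "G 0"] tp_le tp_le_G by (metis order_refl)
  \<comment> \<open>The limit bounds \<open>tp\<close> only weakly; strict growth over one more unit
    of time gives strictness.\<close>
  have tp_less_T: "tp t < T" if "t \<ge> 0" for t
    using tp_less[of t "t + 1"] tp_T[of "t + 1"] that by linarith
  have T_le: "T - tp t \<le> exp (- \<gamma> * t) / (\<gamma> * su 0)" if "t \<ge> 0" for t
  proof -
    have "T \<le> G t"
    proof (rule tendsto_upperbound[OF T])
      show "\<forall>\<^sub>F s in at_top. tp s \<le> G t"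
        using eventually_ge_at_top[of 0] by eventually_elim (rule tp_le_G[OF that])
    qed simp
    then show ?thesis by (simp add: G_def)
  qed

  \<comment> \<open>Convergence of the centre\<close>
  define M where "M = \<bar>Cbar\<bar> + \<bar>MC\<bar> * \<delta>"
  have M: "\<bar>C t\<bar> \<le> M" if "t \<ge> 0" for t
  proof -
    let ?E = "energy k \<mu> \<Phi> (deviation u ubar t) (deviation \<omega> \<omega>bar t)"
    have "?E \<ge> 0" by (simp add: energy_def)
    \<comment> \<open>The sign of \<open>MC\<close> is not prescribed, hence the absolute value; the
      ball then makes the bound uniform in time.\<close>
    then have "MC * ?E \<le> \<bar>MC\<bar> * \<delta>"
      using ball[OF that] by (intro mult_mono) auto
    then show ?thesis using bound_C[OF that] unfolding M_def by linarith
  qed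
  have sr_eq: "sr t = sr 0 * exp (- t / 2)" if "t \<ge> 0" for t
  proof -
    have "((\<lambda>t. sr t * exp (t / 2)) has_real_derivative 0) (at x within {0..})" if "x \<ge> 0" for x
      by (auto intro!: derivative_eq_intros dsr[OF that])
    from mvt_half_line[OF this order_refl that] have "sr t * exp (t / 2) = sr 0"
      by simp
    then show ?thesis by (simp add: exp_minus field_simps)
  qed
  have sr_0: "(sr \<longlongrightarrow> 0) at_top"
  proof (rule Lim_transform_eventually)
    have "filterlim (\<lambda>t::real. - (1 / 2) * t) at_bot at_top"
      by (intro filterlim_tendsto_neg_mult_at_bot[OF tendsto_const] filterlim_ident) auto
    then have "((\<lambda>t::real. exp (- (1 / 2) * t)) \<longlongrightarrow> 0) at_top"
      by (rule filterlim_compose[OF exp_at_bot])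
    then show "((\<lambda>t. sr 0 * exp (- t / 2)) \<longlongrightarrow> 0) at_top"
      using tendsto_mult_right_zero[of "\<lambda>t::real. exp (- t / 2)"] by simp
    show "\<forall>\<^sub>F t in at_top. sr 0 * exp (- t / 2) = sr t"
      using eventually_ge_at_top[of 0] by eventually_elim (rule sr_eq[symmetric])
  qed
  (* 2 * M * sr has derivative - M * sr, so it absorbs the drift of zc in both directions. *)
  have zc_mono: "zc s - 2 * M * sr s \<le> zc t - 2 * M * sr t" if "0 \<le> s" "s \<le> t" for s t
  proof (rule nonneg_derivative_mono_half_line[where f = "\<lambda>t. zc t - 2 * M * sr t"
        and f' = "\<lambda>t. (M - C t) * sr t"])
    fix x :: real assume "x \<ge> 0"
    show "((\<lambda>t. zc t - 2 * M * sr t) has_real_derivative (M - C x) * sr x) (at x within {0..})"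
      by (auto intro!: derivative_eq_intros dsr[OF \<open>x \<ge> 0\<close>] dzc[OF \<open>x \<ge> 0\<close>] simp: algebra_simps)
    show "0 \<le> (M - C x) * sr x"
      using M[OF \<open>x \<ge> 0\<close>] pos(1)[OF \<open>x \<ge> 0\<close>] by simp
  qed (use that in auto)
  have zc_anti: "- (zc s + 2 * M * sr s) \<le> - (zc t + 2 * M * sr t)"
    if "0 \<le> s" "s \<le> t" for s t
  proof (rule nonneg_derivative_mono_half_line[where f = "\<lambda>t. - (zc t + 2 * M * sr t)"
        and f' = "\<lambda>t. (M + C t) * sr t"])
    fix x :: real assume "x \<ge> 0"
    show "((\<lambda>t. - (zc t + 2 * M * sr t)) has_real_derivative (M + C x) * sr x) (at x within {0..})"
      by (auto intro!: derivative_eq_intros dsr[OF \<open>x \<ge> 0\<close>] dzc[OF \<open>x \<ge> 0\<close>] simp: algebra_simps)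
    show "0 \<le> (M + C x) * sr x"
      using M[OF \<open>x \<ge> 0\<close>] pos(1)[OF \<open>x \<ge> 0\<close>] by simp
  qed (use that in auto)
  \<comment> \<open>The increasing quantity lies below the decreasing one, since
    \<open>M * sr t\<close> is nonnegative, and so below the initial value of the latter.\<close>
  have "zc t - 2 * M * sr t \<le> zc 0 + 2 * M * sr 0" if "t \<ge> 0" for t
  proof -
    have "0 \<le> M * sr t"
      using M[of 0] pos(1)[OF that] by simp
    then show ?thesis using zc_anti[of 0 t] that by linarith
  qed
  then obtain Z where "((\<lambda>t. zc t - 2 * M * sr t) \<longlongrightarrow> Z) at_top"
    using bounded_mono_half_line_tendsto[of "\<lambda>t. zc t - 2 * M * sr t"] zc_mono
    by (metis (no_types, lifting))
  \<comment> \<open>The correction \<open>2 * M * sr\<close> vanishes in the limit, so adding it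
    back recovers \<open>zc\<close>.\<close>
  from tendsto_add[OF this tendsto_mult[OF tendsto_const[of "2 * M"] sr_0]]
  have Z: "(zc \<longlongrightarrow> Z) at_top" by simp

  \<comment> \<open>Axial vorticity at the moving centre\<close>
  define J where "J = tp ` {0..}"
  have smooth_v: "smooth_on (J \<times> UNIV) (\<lambda>(t, x). v t x)"
    and axisym: "\<And>t. t \<in> J \<Longrightarrow> axisymmetric (v t)"
    and smooth_ub: "smooth_on (UNIV \<times> UNIV \<times> J) (\<lambda>(r, z, t). ub r z t)"
    and swirl: "\<And>t r z. t \<in> J \<Longrightarrow> r > 0 \<Longrightarrow> ub r z t = azi_comp (v t) r z / r"
    using physical unfolding physical_solution_def smooth_euler_solution_def smooth_even_def J_def
    by blast+
  have vort: "axi_comp (curl (v (tp t))) 0 (zc t) = 2 * ubar 0 0 * su t" if "t \<ge> 0" for t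
  proof -
    have tJ: "tp t \<in> J" using that by (simp add: J_def)
    \<comment> \<open>The swirl quotient determines \<open>ub\<close> only off the axis; continuity
      up to the axis identifies its limit as \<open>ub 0 (zc t) (tp t)\<close>.\<close>
    have "Ck_on 0 (UNIV \<times> UNIV \<times> J) (\<lambda>(r, z, t). ub r z t)"
      using smooth_ub unfolding smooth_on_def by blast
    then have "continuous_on (UNIV \<times> UNIV \<times> J) (\<lambda>(r, z, t). ub r z t)"
      by simp
    then have "continuous_on UNIV (\<lambda>r. (\<lambda>(r, z, t). ub r z t) (r, zc t, tp t))"
      by (rule continuous_on_compose2) (auto intro!: continuous_intros simp: tJ)
    then have "((\<lambda>r. ub r (zc t) (tp t)) \<longlongrightarrow> ub 0 (zc t) (tp t)) (at_right 0)"
      by (simp add: continuous_on_def filterlim_at_split)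
    then have "axi_comp (curl (v (tp t))) 0 (zc t) = 2 * ub 0 (zc t) (tp t)"
      using axial_vorticity_on_axis[OF spatial_derivative[OF smooth_v tJ] axisym[OF tJ]] swirl[OF tJ]
      by blast
    \<comment> \<open>The moving centre is the rescaled origin \<open>r = z = 0\<close>, where the
      normalization fixes \<open>u\<close>.\<close>
    also have "ub 0 (zc t) (tp t) = su t * u 0 0 t"
      using variables that unfolding rescaled_variables_def by (metis add_0_right mult_zero_right order_refl)
    also have "u 0 0 t = ubar 0 0"
      using rescaled that unfolding admissible_rescaled_solution_def by blast
    finally show ?thesis by simp
  qed
  have vort_abs: "\<bar>axi_comp (curl (v (tp t))) 0 (zc t)\<bar> = 2 * \<bar>ubar 0 0\<bar> * su t"
    if "t \<ge> 0" for t
    using vort[OF that] pos(2)[OF that] by (simp add: abs_mult)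
  have su_lim: "filterlim (\<lambda>t. 2 * \<bar>ubar 0 0\<bar> * su t) at_top at_top"
    using profile by (intro filterlim_tendsto_pos_mult_at_top[OF tendsto_const _ su_top]) auto
  have vort_top: "filterlim (\<lambda>t. \<bar>axi_comp (curl (v (tp t))) 0 (zc t)\<bar>) at_top at_top"
  proof (rule filterlim_at_top_mono[OF su_lim])
    show "\<forall>\<^sub>F t in at_top. 2 * \<bar>ubar 0 0\<bar> * su t \<le> \<bar>axi_comp (curl (v (tp t))) 0 (zc t)\<bar>"
      using eventually_ge_at_top[of 0] by eventually_elim (simp add: vort_abs)
  qed

  \<comment> \<open>Blow-up of the supremum norm of the vorticity\<close>
  have norm_e_axi: "norm e_axi = 1"
    by (simp add: e_axi_def norm_eq_sqrt_inner inner_vec_def sum_3)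
  have Linf: "((\<lambda>t. Linf_norm (curl (v (tp t)))) \<longlongrightarrow> \<infinity>) at_top"
  \<comment> \<open>The upper bound is the constant \<open>\<infinity>\<close>, so all the content
    is in the lower bound by the axial component at the centre.\<close>
  proof (rule tendsto_sandwich[where h = "\<lambda>_. \<infinity>"])
    show "((\<lambda>t. ereal \<bar>axi_comp (curl (v (tp t))) 0 (zc t)\<bar>) \<longlongrightarrow> \<infinity>) at_top"
      using vort_top by (rule tendsto_PInfty_eq_at_top[THEN iffD2])
    show "\<forall>\<^sub>F t in at_top.
        ereal \<bar>axi_comp (curl (v (tp t))) 0 (zc t)\<bar> \<le> Linf_norm (curl (v (tp t)))"
      using eventually_ge_at_top[of 0]
    proof eventually_elim
      fix t :: real assume "0 \<le> t"
      then have tJ: "tp t \<in> J" by (simp add: J_def)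
      have "continuous_on UNIV (\<lambda>x. (\<lambda>y. curl (v (fst y)) (snd y)) (tp t, x))"
        by (rule continuous_on_compose2[OF continuous_on_curl[OF smooth_v]])
           (auto intro!: continuous_intros simp: tJ)
      then have "ereal (norm (curl (v (tp t)) (cyl 0 0 (zc t)))) \<le> Linf_norm (curl (v (tp t)))"
        by (intro continuous_le_Linf_norm) simp
      moreover have "\<bar>axi_comp (curl (v (tp t))) 0 (zc t)\<bar> \<le> norm (curl (v (tp t)) (cyl 0 0 (zc t)))"
        unfolding axi_comp_def
        using Cauchy_Schwarz_ineq2[of "curl (v (tp t)) (cyl 0 0 (zc t))" e_axi] norm_e_axi by simp
      ultimately show "ereal \<bar>axi_comp (curl (v (tp t))) 0 (zc t)\<bar> \<le> Linf_norm (curl (v (tp t)))"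
        by (meson ereal_less_eq(3) order_trans)
    qed
  qed auto

  \<comment> \<open>Impossibility of a smooth continuation\<close>
  have no_cont: "\<not> (\<exists>\<epsilon>>0. \<exists>w. smooth_euler_solution {tp 0..<T + \<epsilon>} w \<and>
      (\<forall>t\<in>{tp 0..<T}. \<forall>x. w t x = v t x))"
  proof (intro notI, elim exE conjE)
    fix \<epsilon> :: real and w
    assume "\<epsilon> > 0" and sol: "smooth_euler_solution {tp 0..<T + \<epsilon>} w"
      and agree: "\<forall>t\<in>{tp 0..<T}. \<forall>x. w t x = v t x"
    let ?S = "{tp 0..<T + \<epsilon>}"
    have "continuous_on (?S \<times> UNIV) (\<lambda>y. curl (w (fst y)) (snd y))"
      using sol unfolding smooth_euler_solution_def by (intro continuous_on_curl) blast
    moreover have "((\<lambda>t. (tp t, cyl 0 0 (zc t))) \<longlongrightarrow> (T, cyl 0 0 Z)) at_top"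
    proof -
      have "cyl 0 0 z = z *\<^sub>R e_axi" for z
        by (simp add: cyl_def e_axi_def vec_eq_iff forall_3)
      then show ?thesis using T Z by (auto intro!: tendsto_intros)
    qed
    \<comment> \<open>Here \<open>\<epsilon> > 0\<close> matters: the limit time belongs to the
      half-open interval, so the vorticity of \<open>w\<close> has a finite value there.\<close>
    moreover have "(T, cyl 0 0 Z) \<in> ?S \<times> UNIV"
      using tp_less_T[of 0] \<open>\<epsilon> > 0\<close> by auto
    moreover have "\<forall>\<^sub>F t in at_top. (tp t, cyl 0 0 (zc t)) \<in> ?S \<times> UNIV"
      using eventually_ge_at_top[of 0]
      by eventually_elim (use tp_le tp_less_T \<open>\<epsilon> > 0\<close> in \<open>force intro: add_strict_increasing2 less_trans\<close>)
    ultimately have "((\<lambda>t. curl (w (tp t)) (cyl 0 0 (zc t))) \<longlongrightarrow> curl (w T) (cyl 0 0 Z)) at_top"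
      using continuous_on_tendsto_compose[of "?S \<times> UNIV" "\<lambda>y. curl (w (fst y)) (snd y)"] by fastforce
    then have "((\<lambda>t. \<bar>axi_comp (curl (w (tp t))) 0 (zc t)\<bar>) \<longlongrightarrow> \<bar>axi_comp (curl (w T)) 0 Z\<bar>) at_top"
      unfolding axi_comp_def by (intro tendsto_intros)
    moreover have "\<forall>\<^sub>F t in at_top. \<bar>axi_comp (curl (w (tp t))) 0 (zc t)\<bar>
        = \<bar>axi_comp (curl (v (tp t))) 0 (zc t)\<bar>"
      using eventually_ge_at_top[of 0]
    proof eventually_elim
      fix t :: real assume "0 \<le> t"
      \<comment> \<open>Agreement on the whole spatial slice carries over to the curls; it is
        available because \<open>tp t\<close> is strictly below \<open>T\<close>.\<close>
      then have "w (tp t) = v (tp t)"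
        using agree tp_le[of 0 t] tp_less_T[of t] by auto
      then show "\<bar>axi_comp (curl (w (tp t))) 0 (zc t)\<bar> = \<bar>axi_comp (curl (v (tp t))) 0 (zc t)\<bar>"
        by simp
    qed
    ultimately have "((\<lambda>t. \<bar>axi_comp (curl (v (tp t))) 0 (zc t)\<bar>) \<longlongrightarrow> \<bar>axi_comp (curl (w T)) 0 Z\<bar>) at_top"
      by (rule Lim_transform_eventually)
    then show False
      using vort_top not_tendsto_and_filterlim_at_infinity[of at_top]
        filterlim_at_top_imp_at_infinity trivial_limit_at_top_linorder by blast
  qed

  show ?thesis
    using T tp_less_T T_le Z vort_abs vort_top Linf no_cont by (intro exI[of _ T]) auto
qed

end
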